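(* The C+AG algorithm (defined in the context) for minimizing $f:\mathbb{R}^n\to\mathbb{R}$ has the following properties. (ii) Its running-time bound is $O(\epsilon^{-1/2})$ gradient evaluations if $f$ is an $L$-smooth convex function, where $\epsilon$ is the desired residual reduction. (iii) Its running-time bound is $O(\sqrt{L/\ell}\,\ln(1/\epsilon))$ gradient evaluations if $f$ is both $L$-smooth and $\ell$-strongly convex.
   Context: All norms are Euclidean. A convex function $f$ is $L$-smooth if it is differentiable and $f(\bm y)-f(\bm x)-\nabla f(\bm x)^T(\bm y-\bm x)\le \frac L2\|\bm x-\bm y\|^2$ for all $\bm x,\bm y\in\mathbb{R}^n$. A differentiable $f$ is $\ell$-strongly convex, with modulus $\ell\ge 0$, if $f(\bm y)-f(\bm x)-\nabla f(\bm x)^T(\bm y-\bm x)\ge\frac{\ell}{2}\|\bm x-\bm y\|^2$ for all $\bm x,\bm y\in\mathbb{R}^n$; $\ell=0$ means simply that $f$ is differentiable and convex. The minimum value $f^*=\min f$ is assumed to be attained, at $\bm x^*$. Work is counted in function-gradient evaluations, i.e. simultaneous evaluations of $f$ and $\nabla f$ at one point. The residual is $f(\bm x_k)-f^*$, and the residual reduction in accelerated-gradient-type bounds is $\epsilon=(f(\bm x_k)-f^* )/(L\|\bm x_0-\bm x^*\|^2)$. C+AG algorithm. Inputs: $f$, $\nabla f$, initial point $\bm x_0$, the moduli $L$ and $\ell$ ($\ell=0$ is allowed), and a tolerance gtol. It returns a point as soon as it has evaluated there a gradient of norm at most gtol: this is checked at the points $\tilde{\bm x}$, $\bm x_{k+1}$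 (step types 1 and 2) and $\bar{\bm x}_k$ (step type 3) below. Write $\bm g_k=\nabla f(\bm x_k)$. Initialize $\bm v_0=\bm x_0$, $\phi_0^*=f(\bm x_0)$, $\gamma_0=L$, $\bm p_0=-\bm g_0$, flag onlyAG = false, counters $i_{cg}=i_{ag}=0$. For $k=0,1,2,\ldots$: let $\theta_k$ be the positive root of $L\theta^2+(\gamma_k-\ell)\theta-\gamma_k=0$ and $\gamma_{k+1}=(1-\theta_k)\gamma_k+\theta_k\ell$. For a point $\bar{\bm x}$ define the update $U_k(\bar{\bm x})=(\bm v_{k+1},\phi_{k+1}^* )$ by $$\bm v_{k+1}=\tfrac1{\gamma_{k+1}}\left[(1-\theta_k)\gamma_k\bm v_k+\theta_k\ell\bar{\bm x}-\theta_k\nabla f(\bar{\bm x})\right],$$ $$\phi_{k+1}^*=(1-\theta_k)\phi_k^*+\theta_kf(\bar{\bm x})-\tfrac{\theta_k^2}{2\gamma_{k+1}}\|\nabla f(\bar{\bm x})\|^2+\tfrac{\theta_k(1-\theta_k)\gamma_k}{\gamma_{k+1}}\left(\tfrac{\ell}{2}\|\bar{\bm x}-\bm v_k\|^2+\nabla f(\bar{\bm x})^T(\bm v_k-\bar{\bm x})\right).$$ Try the following step types in order until one is accepted (types 1 and 2 are skipped if onlyAG is true). Types 1 (conjugate gradient) and 2 (steepest descent restart): if the type is 2, or if $i_{cg}\ge 6n+1$, reset $\bm p_k=-\bm g_k$ and $i_{cg}=0$. Increase $i_{cg}$ by 1 and set $i_{ag}=0$. Evaluate $f,\nabla f$ at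 $\tilde{\bm x}=\bm x_k+\bm p_k/L$; let $\bm s=L(\nabla f(\tilde{\bm x})-\bm g_k)$. If $\bm g_k^T\bm p_k\ge0$ or $\bm p_k^T\bm s\le0$, the step type fails. Otherwise set $\alpha_k=-\bm g_k^T\bm p_k/(\bm p_k^T\bm s)$, $\bm x_{k+1}=\bm x_k+\alpha_k\bm p_k$, evaluate $f,\nabla f$ at $\bm x_{k+1}$, and set $(\bm v_{k+1},\phi_{k+1}^* )=U_k(\bm x_k)$. The step is accepted if and only if $f(\bm x_{k+1})\le\phi_{k+1}^*$; in that case put $\hat{\bm y}=\bm g_{k+1}-\bm g_k$, $\beta^1=\left(\hat{\bm y}-\bm p_k\frac{2\|\hat{\bm y}\|^2}{\hat{\bm y}^T\bm p_k}\right)^T\frac{\bm g_{k+1}}{\hat{\bm y}^T\bm p_k}$, $\beta^2=\frac{-1}{\|\bm p_k\|\min(0.01\|\bm g_0\|,\|\bm g_{k+1}\|)}$, $\beta_{k+1}=\max(\beta^1,\beta^2)$, $\bm p_{k+1}=-\bm g_{k+1}+\beta_{k+1}\bm p_k$, and go to the next $k$. Type 3 (accelerated gradient; always accepted): if onlyAG is false, set it to true and $i_{ag}=i_{cg}=0$. Increase $i_{ag}$ by 1. Let $\bar{\bm x}_k=\frac{\theta_k\gamma_k\bm v_k+\gamma_{k+1}\bm x_k}{\gamma_k+\theta_k\ell}$, evaluate $f,\nabla f$ at $\bar{\bm x}_k$, set $\bm x_{k+1}=\bar{\bm x}_k-\nabla f(\bar{\bm x}_k)/L$ and $(\bm v_{k+1},\phi_{k+1}^*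 )=U_k(\bar{\bm x}_k)$. If $i_{ag}$ is divisible by 8, also evaluate $f,\nabla f$ at $\bm x_{k+1}$, and if $f(\bm x_{k+1})\le f(\bar{\bm x}_k)-\frac45\cdot\frac{\nabla f(\bar{\bm x}_k)^T(\nabla f(\bar{\bm x}_k)+\bm g_{k+1})}{2L}$, set $\bm p_{k+1}=-\bm g_{k+1}$ and onlyAG = false. *)

theory Defs
  imports Complex_Main "Jordan_Normal_Form.Matrix"
begin

text \<open>Points of \<open>\<real>^n\<close> are vectors in \<^term>\<open>carrier_vec n\<close>, so that the dimension can be
  quantified inside the scope of an \<open>O\<close>-constant; with a type \<open>real ^ 'n\<close> that constant
  would be allowed to depend on the dimension.  The price is that differentiability has to be
  written out.\<close>

definition vnorm :: "real vec \<Rightarrow> real" where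
  "vnorm x = sqrt (x \<bullet> x)"

definition is_gradient :: "nat \<Rightarrow> (real vec \<Rightarrow> real) \<Rightarrow> (real vec \<Rightarrow> real vec) \<Rightarrow> bool" where
  "is_gradient n f df \<longleftrightarrow>
     (\<forall>x\<in>carrier_vec n. df x \<in> carrier_vec n \<and>
        (\<forall>e>0. \<exists>d>0. \<forall>y\<in>carrier_vec n. vnorm (y - x) < d \<longrightarrow>
           \<bar>f y - f x - df x \<bullet> (y - x)\<bar> \<le> e * vnorm (y - x)))"

definition convex_fun :: "nat \<Rightarrow> (real vec \<Rightarrow> real) \<Rightarrow> bool" where
  "convex_fun n f \<longleftrightarrow>
     (\<forall>x\<in>carrier_vec n. \<forall>y\<in>carrier_vec n. \<forall>t. 0 \<le> t \<and> t \<le> 1 \<longrightarrow>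
        f ((1 - t) \<cdot>\<^sub>v x + t \<cdot>\<^sub>v y) \<le> (1 - t) * f x + t * f y)"

definition L_smooth ::
  "nat \<Rightarrow> real \<Rightarrow> (real vec \<Rightarrow> real) \<Rightarrow> (real vec \<Rightarrow> real vec) \<Rightarrow> bool" where
  "L_smooth n L f df \<longleftrightarrow>
     convex_fun n f \<and> is_gradient n f df \<and>
     (\<forall>x\<in>carrier_vec n. \<forall>y\<in>carrier_vec n.
        f y - f x - df x \<bullet> (y - x) \<le> L / 2 * (vnorm (x - y))\<^sup>2)"

definition strongly_convex ::
  "nat \<Rightarrow> real \<Rightarrow> (real vec \<Rightarrow> real) \<Rightarrow> (real vec \<Rightarrow> real vec) \<Rightarrow> bool" where
  "strongly_convex n ell f df \<longleftrightarrow>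
     is_gradient n f df \<and>
     (\<forall>x\<in>carrier_vec n. \<forall>y\<in>carrier_vec n.
        f y - f x - df x \<bullet> (y - x) \<ge> ell / 2 * (vnorm (x - y))\<^sup>2)"

definition is_minimizer :: "nat \<Rightarrow> (real vec \<Rightarrow> real) \<Rightarrow> real vec \<Rightarrow> bool" where
  "is_minimizer n f xs \<longleftrightarrow> xs \<in> carrier_vec n \<and> (\<forall>y\<in>carrier_vec n. f xs \<le> f y)"

text \<open>State at the start of an iteration; \<open>work\<close> is the number of function-gradient evaluations
  made so far, repeated evaluations at the same point counted separately.\<close>

record cag_state =
  xk :: "real vec"
  vk :: "real vec"
  phik :: real
  gammak :: real
  pk :: "real vec"
  onlyAG :: bool
  icg :: nat
  iag :: nat
  work :: nat

text \<open>\<open>Returned z w\<close>: the gradient test succeeded at \<open>z\<close>, after \<open>w\<close> evaluations in total.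
  \<open>Failed s\<close>: a step of type 1 or 2 was not accepted; the counters and the work spent on it
  are kept in \<open>s\<close>.\<close>

datatype outcome = Accepted cag_state | Failed cag_state | Returned "real vec" nat

locale cag =
  fixes n :: nat
    and f :: "real vec \<Rightarrow> real"
    and df :: "real vec \<Rightarrow> real vec"
    and L :: real
    and ell :: real
    and gtol :: real
    and x0 :: "real vec"
begin

definition theta :: "cag_state \<Rightarrow> real" where
  "theta s = (THE t. 0 < t \<and> L * t\<^sup>2 + (gammak s - ell) * t - gammak s = 0)"

definition gamma_next :: "cag_state \<Rightarrow> real" where
  "gamma_next s = (1 - theta s) * gammak s + theta s * ell"

definition v_next :: "cag_state \<Rightarrow> real vec \<Rightarrow> real vec" where
  "v_next s y = (1 / gamma_next s) \<cdot>\<^sub>v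
     (((1 - theta s) * gammak s) \<cdot>\<^sub>v vk s + (theta s * ell) \<cdot>\<^sub>v y - theta s \<cdot>\<^sub>v df y)"

definition phi_next :: "cag_state \<Rightarrow> real vec \<Rightarrow> real" where
  "phi_next s y =
     (1 - theta s) * phik s + theta s * f y
       - (theta s)\<^sup>2 / (2 * gamma_next s) * (vnorm (df y))\<^sup>2
       + theta s * (1 - theta s) * gammak s / gamma_next s *
           (ell / 2 * (vnorm (y - vk s))\<^sup>2 + df y \<bullet> (vk s - y))"

text \<open>Arguments: \<open>p = p\<^sub>k\<close>, \<open>g = g\<^sub>k\<close>, \<open>g' = g\<^sub>k\<^sub>+\<^sub>1\<close>.  Vanishing denominators
  follow the convention \<open>a / 0 = 0\<close>.\<close>

definition beta :: "real vec \<Rightarrow> real vec \<Rightarrow> real vec \<Rightarrow> real" where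
  "beta p g g' =
     (let y = g' - g;
          b1 = (y - (2 * (vnorm y)\<^sup>2 / (y \<bullet> p)) \<cdot>\<^sub>v p) \<bullet> ((1 / (y \<bullet> p)) \<cdot>\<^sub>v g');
          b2 = - 1 / (vnorm p * min (0.01 * vnorm (df x0)) (vnorm g'))
      in max b1 b2)"

text \<open>\<open>cg_step False\<close> is step type 1, \<open>cg_step True\<close> is step type 2.\<close>

definition cg_step :: "bool \<Rightarrow> cag_state \<Rightarrow> outcome" where
  "cg_step restart s =
     (let g = df (xk s);
          reset = (restart \<or> icg s \<ge> 6 * n + 1);
          p = (if reset then - g else pk s);
          s1 = s\<lparr>pk := p, icg := (if reset then 0 else icg s) + 1, iag := 0,
                 work := work s + 1\<rparr>;
          xt = xk s + (1 / L) \<cdot>\<^sub>v p;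
          d = L \<cdot>\<^sub>v (df xt - g)
      in if vnorm (df xt) \<le> gtol then Returned xt (work s1)
         else if g \<bullet> p \<ge> 0 \<or> p \<bullet> d \<le> 0 then Failed s1
         else
           (let \<alpha> = - (g \<bullet> p) / (p \<bullet> d);
                x' = xk s + \<alpha> \<cdot>\<^sub>v p;
                g' = df x';
                s2 = s1\<lparr>work := work s1 + 1\<rparr>
            in if vnorm g' \<le> gtol then Returned x' (work s2)
               else if f x' \<le> phi_next s (xk s)
               then Accepted (s2\<lparr>xk := x', vk := v_next s (xk s), phik := phi_next s (xk s),
                                 gammak := gamma_next s,
                                 pk := - g' + beta p g g' \<cdot>\<^sub>v p\<rparr>)
               else Failed s2))"

text \<open>Step type 3.  Unless the block of accelerated steps ends, \<open>pk\<close> is left unchanged; it is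
  then not used before it is reassigned.\<close>

definition ag_step :: "cag_state \<Rightarrow> outcome" where
  "ag_step s =
     (let s1 = (if onlyAG s then s else s\<lparr>onlyAG := True, iag := 0, icg := 0\<rparr>);
          i = iag s1 + 1;
          y = (1 / (gammak s + theta s * ell)) \<cdot>\<^sub>v
                ((theta s * gammak s) \<cdot>\<^sub>v vk s + gamma_next s \<cdot>\<^sub>v xk s);
          x' = y - (1 / L) \<cdot>\<^sub>v df y;
          s2 = s1\<lparr>iag := i, work := work s + 1, xk := x', vk := v_next s y,
                  phik := phi_next s y, gammak := gamma_next s\<rparr>
      in if vnorm (df y) \<le> gtol then Returned y (work s2)
         else if 8 dvd i then
           (let s3 = s2\<lparr>work := work s2 + 1\<rparr>
            in if f x' \<le> f y - 4 / 5 * ((df y \<bullet> (df y + df x')) / (2 * L))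
               then Accepted (s3\<lparr>pk := - df x', onlyAG := False\<rparr>)
               else Accepted s3)
         else Accepted s2)"

definition iteration :: "cag_state \<Rightarrow> outcome" where
  "iteration s =
     (if onlyAG s then ag_step s
      else (case cg_step False s of
              Failed s1 \<Rightarrow> (case cg_step True s1 of Failed s2 \<Rightarrow> ag_step s2 | r \<Rightarrow> r)
            | r \<Rightarrow> r))"

definition init :: cag_state where
  "init = \<lparr>xk = x0, vk = x0, phik = f x0, gammak = L, pk = - df x0, onlyAG = False,
           icg = 0, iag = 0, work = 1\<rparr>"

fun run :: "nat \<Rightarrow> outcome" where
  "run 0 = Accepted init"
| "run (Suc k) = (case run k of Accepted s \<Rightarrow> iteration s | r \<Rightarrow> r)"

text \<open>After at most \<open>B\<close> evaluations, either an iterate \<open>x\<^sub>k\<close> with residual reduction at most \<open>\<epsilon>\<close>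
  (relative to the minimizer \<open>xs\<close>) has been computed, or the algorithm has returned because of
  its gradient test; for \<open>gtol = 0\<close> the latter means that it has returned a minimizer.
  The division by \<open>L * (vnorm (x0 - xs))\<^sup>2\<close> is cleared.

  By \<open>L\<close>-smoothness \<open>x0\<close> has residual reduction at most \<open>1/2\<close>, so bounds are only of interest for
  \<open>\<epsilon> \<le> 1/2\<close>; a bound \<open>C * ln (1 / \<epsilon>)\<close> without additive constant must keep \<open>\<epsilon>\<close> away from 1.\<close>

definition reaches_within :: "real vec \<Rightarrow> real \<Rightarrow> real \<Rightarrow> bool" where
  "reaches_within xs \<epsilon> B \<longleftrightarrow>
     (\<exists>k. (\<exists>s. run k = Accepted s \<and> real (work s) \<le> B \<and>
               f (xk s) - f xs \<le> \<epsilon> * (L * (vnorm (x0 - xs))\<^sup>2)) \<or>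
          (\<exists>z w. run k = Returned z w \<and> real w \<le> B \<and> vnorm (df z) \<le> gtol))"

end

end

(* The updates of v, phi* and gamma maintain Nesterov's estimate sequence no matter at which point
   the gradient is taken, so the lower estimate of phi* survives conjugate-gradient steps as well;
   the inequality f(x_k) <= phi*_k is the acceptance test of those steps, and a theorem for
   accelerated steps.  Hence f(x_k) - f* <= kappa_k L |x_0 - x*|^2, where kappa_k is the product
   of the factors 1 - theta_i.  From gamma_k = ell + kappa_k (L - ell) and
   L theta_k^2 = gamma_{k+1} one gets theta_k >= sqrt (kappa_{k+1}) and theta_k >= sqrt (ell / L),
   thus kappa_k <= 4 / (k + 2)^2 and kappa_k <= (1 - sqrt (ell / L))^k.  An iteration costs at
   most six evaluations. *)

theory Submission
  imports Defs
begin

section \<open>The Euclidean norm on coordinate vectors\<close>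

lemma scalar_prod_self_nonneg: "0 \<le> (x :: real vec) \<bullet> x"
  by (simp add: scalar_prod_def sum_nonneg)

lemma vnorm_nonneg: "0 \<le> vnorm x"
  by (simp add: vnorm_def scalar_prod_self_nonneg)

lemma vnorm_power2: "(vnorm x)\<^sup>2 = x \<bullet> x"
  by (simp add: vnorm_def scalar_prod_self_nonneg)

lemma vnorm_smult: "vnorm (c \<cdot>\<^sub>v x) = \<bar>c\<bar> * vnorm x"
proof -
  have "(c \<cdot>\<^sub>v x) \<bullet> (c \<cdot>\<^sub>v x) = c\<^sup>2 * (x \<bullet> x)"
    by (simp add: scalar_prod_def sum_distrib_left power2_eq_square ac_simps)
  then show ?thesis
    by (simp add: vnorm_def real_sqrt_mult)
qed

lemma vnorm_minus_commute:
  assumes "x \<in> carrier_vec n" "y \<in> carrier_vec n"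
  shows "vnorm (x - y) = vnorm (y - x)"
proof -
  have "x - y = (- 1) \<cdot>\<^sub>v (y - x)"
    using assms by (intro eq_vecI) auto
  then show ?thesis
    by (simp add: vnorm_smult)
qed

section \<open>First-order consequences of differentiability, convexity and smoothness\<close>

text \<open>A single small step with first-order error at most \<open>e * t\<close> replaces the
  limits in the next two lemmas; \<open>t \<le> 1\<close> keeps the point on the segment when
  \<open>h = y - x\<close>.\<close>

lemma directional_derivative:
  assumes grad: "is_gradient n f df" and x: "x \<in> carrier_vec n" and h: "h \<in> carrier_vec n"
    and e: "0 < e"
  obtains t where "0 < t" "t \<le> 1" "\<bar>f (x + t \<cdot>\<^sub>v h) - f x - t * (df x \<bullet> h)\<bar> \<le> e * t"
proof -
  \<comment> \<open>Adding 1 permits division by \<open>r\<close> even if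
    \<open>h = 0\<close>.\<close>
  define r where "r = vnorm h + 1"
  have r: "0 < r" "vnorm h \<le> r"
    using vnorm_nonneg[of h] by (auto simp: r_def)
  have g: "df x \<in> carrier_vec n"
    using grad x by (simp add: is_gradient_def)
  have "0 < e / r"
    using e r by simp
  then obtain d where d: "0 < d" "\<And>y. y \<in> carrier_vec n \<Longrightarrow> vnorm (y - x) < d \<Longrightarrow>
      \<bar>f y - f x - df x \<bullet> (y - x)\<bar> \<le> e / r * vnorm (y - x)"
    using grad x unfolding is_gradient_def by meson
  define t where "t = min 1 (d / (2 * r))"
  have t: "0 < t" "t \<le> 1" "t \<le> d / (2 * r)"
    using d r by (auto simp: t_def)
  have diff: "(x + t \<cdot>\<^sub>v h) - x = t \<cdot>\<^sub>v h"
    using x h by (intro eq_vecI) auto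
  have "t * vnorm h \<le> t * r"
    using t r by simp
  moreover have "t * r \<le> d / 2"
    using t(3) r by (simp add: field_simps)
  ultimately have "t * vnorm h < d"
    using d(1) by linarith
  then have "vnorm (t \<cdot>\<^sub>v h) < d"
    using t(1) by (simp add: vnorm_smult)
  then have "\<bar>f (x + t \<cdot>\<^sub>v h) - f x - t * (df x \<bullet> h)\<bar> \<le> e / r * (t * vnorm h)"
    using d(2)[of "x + t \<cdot>\<^sub>v h"] x h g t unfolding diff by (simp add: vnorm_smult)
  also have "\<dots> \<le> e / r * (t * r)"
    using t r e by (intro mult_left_mono) auto
  also have "\<dots> = e * t"
    using r by simp
  finally show ?thesis
    using that t by blast
qed

text \<open>Convexity along the segment, compared with the first-order expansion and divided by
  \<open>t\<close>, gives the claim up to an arbitrary \<open>e\<close>.\<close>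

lemma convex_fun_gradient_ineq:
  assumes conv: "convex_fun n f" and grad: "is_gradient n f df"
    and x: "x \<in> carrier_vec n" and y: "y \<in> carrier_vec n"
  shows "df x \<bullet> (y - x) \<le> f y - f x"
proof (rule field_le_epsilon)
  fix e :: real
  assume "0 < e"
  have "y - x \<in> carrier_vec n"
    using x y by simp
  then obtain t where t: "0 < t" "t \<le> 1"
    "\<bar>f (x + t \<cdot>\<^sub>v (y - x)) - f x - t * (df x \<bullet> (y - x))\<bar> \<le> e * t"
    using directional_derivative[OF grad x _ \<open>0 < e\<close>] by blast
  have "x + t \<cdot>\<^sub>v (y - x) = (1 - t) \<cdot>\<^sub>v x + t \<cdot>\<^sub>v y"
    using x y by (intro eq_vecI) (auto simp: algebra_simps)
  then have "f (x + t \<cdot>\<^sub>v (y - x)) \<le> (1 - t) * f x + t * f y"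
    using conv t x y by (simp add: convex_fun_def)
  then have "t * (df x \<bullet> (y - x)) \<le> t * (f y - f x + e)"
    using t(3) by (simp add: algebra_simps)
  then show "df x \<bullet> (y - x) \<le> f y - f x + e"
    using t(1) by simp
qed

text \<open>A direction of negative slope would lead below the minimum. Since \<open>h\<close> is
  arbitrary, this one-sided form expresses that the gradient vanishes at \<open>xs\<close>.\<close>

lemma minimizer_gradient_nonneg:
  assumes grad: "is_gradient n f df" and min: "is_minimizer n f xs" and h: "h \<in> carrier_vec n"
  shows "0 \<le> df xs \<bullet> h"
proof (rule field_le_epsilon)
  fix e :: real
  assume "0 < e"
  have xs: "xs \<in> carrier_vec n"
    using min by (simp add: is_minimizer_def)
  obtain t where t: "0 < t" "t \<le> 1" "\<bar>f (xs + t \<cdot>\<^sub>v h) - f xs - t * (df xs \<bullet> h)\<bar> \<le> e * t"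
    using directional_derivative[OF grad xs h \<open>0 < e\<close>] by blast
  have "f xs \<le> f (xs + t \<cdot>\<^sub>v h)"
    using min h xs by (simp add: is_minimizer_def)
  then have "0 \<le> t * (df xs \<bullet> h + e)"
    using t(3) by (simp add: algebra_simps)
  then show "0 \<le> df xs \<bullet> h + e"
    using t(1) by (simp add: zero_le_mult_iff)
qed

text \<open>Supplies one half of the factor \<open>L\<close> in the final residual bound; the other
  half comes from the initial quadratic of the estimate sequence.\<close>

lemma minimizer_residual_le:
  assumes smooth: "L_smooth n L f df" and min: "is_minimizer n f xs" and x: "x \<in> carrier_vec n"
  shows "f x - f xs \<le> L / 2 * (vnorm (x - xs))\<^sup>2"
proof -
  have xs: "xs \<in> carrier_vec n"
    using min by (simp add: is_minimizer_def)
  have grad: "is_gradient n f df"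
    using smooth by (simp add: L_smooth_def)
  have g: "df xs \<in> carrier_vec n"
    using grad xs by (simp add: is_gradient_def)
  have "0 \<le> df xs \<bullet> (xs - x)"
    using minimizer_gradient_nonneg[OF grad min] x xs by simp
  then have "df xs \<bullet> (x - xs) \<le> 0"
    using g x xs by (simp add: scalar_prod_minus_distrib)
  moreover have "f x - f xs - df xs \<bullet> (x - xs) \<le> L / 2 * (vnorm (xs - x))\<^sup>2"
    using smooth x xs by (simp add: L_smooth_def)
  ultimately show ?thesis
    using vnorm_minus_commute[OF x xs] by simp
qed

text \<open>The upper and lower quadratic bounds are compared at two points of distance 1, which
  exist because the dimension is positive.\<close>

lemma strong_convexity_le_smoothness:
  assumes "L_smooth n L f df" "strongly_convex n ell f df" "1 \<le> n"
  shows "ell \<le> L"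
proof -
  let ?u = "unit_vec n 0 :: real vec" and ?z = "0\<^sub>v n :: real vec"
  have d: "vnorm (?z - ?u) = 1"
  proof -
    have "?z - ?u = (- 1) \<cdot>\<^sub>v ?u"
      by (intro eq_vecI) auto
    moreover have "?u \<bullet> ?u = 1"
      using assms(3) by (simp add: scalar_prod_left_unit)
    ultimately show ?thesis
      by (simp add: vnorm_smult) (simp add: vnorm_def)
  qed
  have "f ?u - f ?z - df ?z \<bullet> (?u - ?z) \<le> L / 2 * (vnorm (?z - ?u))\<^sup>2"
    using assms(1) unfolding L_smooth_def by (meson unit_vec_carrier zero_carrier_vec)
  moreover have "ell / 2 * (vnorm (?z - ?u))\<^sup>2 \<le> f ?u - f ?z - df ?z \<bullet> (?u - ?z)"
    using assms(2) unfolding strongly_convex_def by (meson unit_vec_carrier zero_carrier_vec)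
  ultimately show ?thesis
    unfolding d power_one by linarith
qed

(* Step of the recursion 1 / sqrt (kappa_{k+1}) >= 1 / sqrt (kappa_k) + 1 / 2, with the
   denominators cleared because kappa vanishes if ell = L. *)
lemma sqrt_contraction_step:
  fixes a b \<theta> c :: real
  assumes a: "0 \<le> a" and b: "0 \<le> b" and eq: "b\<^sup>2 = (1 - \<theta>) * a\<^sup>2" and \<theta>: "b \<le> \<theta>"
    and c: "0 \<le> c" "a * c \<le> 1"
  shows "b * (c + 1 / 2) \<le> 1"
proof -
  \<comment> \<open>Replacing \<open>\<theta>\<close> by the smaller \<open>b\<close> in
    \<open>eq\<close> leaves a relation between \<open>a\<close> and \<open>b\<close> alone.\<close>
  have le: "b\<^sup>2 + a\<^sup>2 * b \<le> a\<^sup>2"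
    using eq mult_right_mono[OF \<theta>, of "a\<^sup>2"] by (simp add: algebra_simps)
  \<comment> \<open>This is 1/b \<ge> 1/a + 1/2 without denominators. At b = 2a/(2 + a) the left
    side of \<open>le\<close>, which increases with b, already exceeds a^2 by a^4/(2 + a)^2; the
    computation is this comparison times (2 + a)^2.\<close>
  have "b * (2 + a) \<le> 2 * a"
  proof (rule ccontr)
    assume "\<not> ?thesis"
    then have gt: "2 * a < b * (2 + a)"
      by simp
    have "(2 * a)\<^sup>2 < (b * (2 + a))\<^sup>2"
      using gt a by (intro power_strict_mono) auto
    also have "\<dots> = (b\<^sup>2 + a\<^sup>2 * b) * (2 + a)\<^sup>2 - (b * (2 + a)) * (a\<^sup>2 * (2 + a))"
      by (simp add: algebra_simps power2_eq_square)
    also have "\<dots> \<le> a\<^sup>2 * (2 + a)\<^sup>2 - (2 * a) * (a\<^sup>2 * (2 + a))"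
      using le gt a by (intro diff_mono mult_right_mono) auto
    also have "\<dots> = (2 * a)\<^sup>2 - a ^ 4"
      by (simp add: algebra_simps power2_eq_square power4_eq_xxxx)
    finally show False
      by simp
  qed
  then have "b * (2 + a) * (2 * c + 1) \<le> 2 * a * (2 * c + 1)"
    using c by (intro mult_right_mono) auto
  also have "\<dots> \<le> 2 * (2 + a)"
    using c by (simp add: algebra_simps)
  finally have "(2 + a) * (b * (2 * c + 1)) \<le> (2 + a) * 2"
    by (simp add: algebra_simps)
  then have "b * (2 * c + 1) \<le> 2"
    by (rule mult_left_le_imp_le) (use a in simp)
  then show ?thesis
    by (simp add: algebra_simps)
qed

section \<open>The common setting of both rates\<close>

text \<open>The assumption \<open>lower\<close> treats both cases at once: for
  \<open>ell = 0\<close> it is the gradient inequality of a convex function, otherwise strong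
  convexity.\<close>

locale cag_convergence = cag +
  fixes xs :: "real vec"
  assumes L_pos: "0 < L" and ell_nonneg: "0 \<le> ell" and ell_le: "ell \<le> L"
    and smooth: "L_smooth n L f df"
    and lower: "\<And>x y. x \<in> carrier_vec n \<Longrightarrow> y \<in> carrier_vec n \<Longrightarrow>
      ell / 2 * (vnorm (x - y))\<^sup>2 \<le> f y - f x - df x \<bullet> (y - x)"
    and x0: "x0 \<in> carrier_vec n" and minimizer: "is_minimizer n f xs"
begin

lemma df_carrier: "x \<in> carrier_vec n \<Longrightarrow> df x \<in> carrier_vec n"
  using smooth by (simp add: L_smooth_def is_gradient_def)

lemma xs_carrier: "xs \<in> carrier_vec n"
  using minimizer by (simp add: is_minimizer_def)

lemma gradient_ineq:
  assumes "x \<in> carrier_vec n" "y \<in> carrier_vec n"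
  shows "f x + df x \<bullet> (y - x) \<le> f y"
proof -
  have "0 \<le> ell / 2 * (vnorm (x - y))\<^sup>2"
    using ell_nonneg by simp
  then show ?thesis
    using lower[OF assms] by linarith
qed

text \<open>Along the step -g/L the linear term contributes -|g|^2/L and smoothness gives back at
  most half of it.\<close>

lemma gradient_step_decrease:
  assumes y: "y \<in> carrier_vec n"
  shows "f (y - (1 / L) \<cdot>\<^sub>v df y) \<le> f y - (vnorm (df y))\<^sup>2 / (2 * L)"
proof -
  let ?x = "y - (1 / L) \<cdot>\<^sub>v df y"
  have g: "df y \<in> carrier_vec n"
    using y by (rule df_carrier)
  have d: "?x - y = (- (1 / L)) \<cdot>\<^sub>v df y" "y - ?x = (1 / L) \<cdot>\<^sub>v df y"
    using y g by (auto intro!: eq_vecI)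
  have "f ?x - f y - df y \<bullet> (?x - y) \<le> L / 2 * (vnorm (y - ?x))\<^sup>2"
    using smooth y g by (simp add: L_smooth_def)
  then have "f ?x - f y + (vnorm (df y))\<^sup>2 / L \<le> L / 2 * ((vnorm (df y))\<^sup>2 / L\<^sup>2)"
    using g L_pos unfolding d
    by (simp add: vnorm_smult vnorm_power2 power_mult_distrib power_divide)
  moreover have "L / 2 * ((vnorm (df y))\<^sup>2 / L\<^sup>2) = (vnorm (df y))\<^sup>2 / (2 * L)"
    using L_pos by (simp add: power2_eq_square)
  moreover have "(vnorm (df y))\<^sup>2 / L = 2 * ((vnorm (df y))\<^sup>2 / (2 * L))"
    by simp
  ultimately show ?thesis
    by linarith
qed

text \<open>The quadratic is negative at 0 and equals \<open>L - ell \<ge> 0\<close> at 1, hence has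
  a root in (0, 1]. By Vieta the product of two distinct roots is negative, so the positive root is
  unique and \<open>THE\<close> picks it. The last claim is the quadratic equation
  rearranged.\<close>

lemma theta_props:
  assumes pos: "0 < gammak s"
  shows "0 < theta s" "theta s \<le> 1" "L * (theta s)\<^sup>2 = gamma_next s"
proof -
  let ?q = "\<lambda>t. L * t\<^sup>2 + (gammak s - ell) * t - gammak s"
  have "\<exists>t. 0 \<le> t \<and> t \<le> 1 \<and> ?q t = 0"
    using pos ell_le by (intro IVT') (auto intro!: continuous_intros)
  then obtain t where t: "0 \<le> t" "t \<le> 1" "?q t = 0"
    by blast
  have t_pos: "0 < t"
    using t pos by (cases "t = 0") (simp, linarith)
  have "u = t" if u: "0 < u" "?q u = 0" for u
  proof (rule ccontr)
    assume "u \<noteq> t"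
    have "(u - t) * (L * (u + t) + (gammak s - ell)) = ?q u - ?q t"
      by (simp add: algebra_simps power2_eq_square)
    also have "\<dots> = 0"
      by (simp only: u(2) t(3))
    finally have sum: "L * (u + t) + (gammak s - ell) = 0"
      using \<open>u \<noteq> t\<close> by simp
    have "?q t = t * (L * (u + t) + (gammak s - ell)) - L * (t * u) - gammak s"
      by (simp add: algebra_simps power2_eq_square)
    then have "gammak s = - (L * (t * u))"
      unfolding sum t(3) by simp
    moreover have "0 < L * (t * u)"
      using L_pos t_pos u by simp
    ultimately show False
      using pos by simp
  qed
  with t(3) t_pos have "theta s = t"
    unfolding theta_def by (intro the_equality) blast+
  moreover have "L * t\<^sup>2 = (1 - t) * gammak s + t * ell"
    using t(3) by argo
  ultimately show "0 < theta s" "theta s \<le> 1" "L * (theta s)\<^sup>2 = gamma_next s"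
    using t(2) t_pos by (simp_all add: gamma_next_def)
qed

lemma gamma_next_pos:
  assumes pos: "0 < gammak s"
  shows "0 < gamma_next s"
proof -
  have "0 < L * (theta s)\<^sup>2"
    using theta_props(1)[OF pos] L_pos by simp
  then show ?thesis
    by (simp only: theta_props(3)[OF pos])
qed

section \<open>Nesterov's estimate sequence\<close>

lemma v_next_carrier:
  assumes "vk s \<in> carrier_vec n" "y \<in> carrier_vec n"
  shows "v_next s y \<in> carrier_vec n"
  using assms df_carrier by (simp add: v_next_def)

text \<open>The right side averages the old quadratic and the lower model of f at \<open>y\<close>.
  As a function of \<open>z\<close> it is a quadratic of curvature \<open>gamma_next s\<close>, with
  minimizer \<open>v_next s y\<close> and minimum value \<open>phi_next s y\<close>; the identity
  completes the square.\<close>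

lemma estimate_update:
  assumes pos: "0 < gammak s" and v: "vk s \<in> carrier_vec n" and y: "y \<in> carrier_vec n"
    and z: "z \<in> carrier_vec n"
  shows "phi_next s y + gamma_next s / 2 * (vnorm (z - v_next s y))\<^sup>2 =
    (1 - theta s) * (phik s + gammak s / 2 * (vnorm (z - vk s))\<^sup>2)
    + theta s * (f y + df y \<bullet> (z - y) + ell / 2 * (vnorm (y - z))\<^sup>2)"
proof -
  define u where "u = vk s - y"
  define w where "w = z - y"
  define g where "g = df y"
  define t where "t = theta s"
  define c where "c = gammak s"
  define c' where "c' = gamma_next s"
  have car: "u \<in> carrier_vec n" "w \<in> carrier_vec n" "g \<in> carrier_vec n"
    using v y z df_carrier by (auto simp: u_def w_def g_def)
  have c'_pos: "0 < c'"
    using gamma_next_pos[OF pos] by (simp add: c'_def)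
  have c': "c' = (1 - t) * c + t * ell"
    by (simp add: c'_def gamma_next_def t_def c_def)
  \<comment> \<open>With \<open>y\<close> as origin, the new center is a u - b g: subtracting
    \<open>y\<close> absorbs the term t ell y because c' - t ell = (1 - t) c.\<close>
  define a where "a = (1 - t) * c / c'"
  define b where "b = t / c'"
  have ab: "a * c' = (1 - t) * c" "b * c' = t"
    using c'_pos by (auto simp: a_def b_def)
  have 1: "z - v_next s y = w - a \<cdot>\<^sub>v u + b \<cdot>\<^sub>v g"
  proof (rule eq_vecI)
    show "dim_vec (z - v_next s y) = dim_vec (w - a \<cdot>\<^sub>v u + b \<cdot>\<^sub>v g)"
      using v_next_carrier[OF v y] car z by simp
    fix i
    assume "i < dim_vec (w - a \<cdot>\<^sub>v u + b \<cdot>\<^sub>v g)"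
    then have i: "i < n"
      using car by simp
    have "z $ i - 1 / c' * ((1 - t) * c * vk s $ i + t * ell * y $ i - t * g $ i) =
        z $ i - y $ i - a * (vk s $ i - y $ i) + b * g $ i"
      using c'_pos unfolding a_def b_def
      by (simp add: field_simps) (simp add: c' algebra_simps)
    then show "(z - v_next s y) $ i = (w - a \<cdot>\<^sub>v u + b \<cdot>\<^sub>v g) $ i"
      using i v y z df_carrier[OF y]
      by (simp add: v_next_def u_def w_def g_def t_def c_def c'_def)
  qed
  have 2: "z - vk s = w - u" "vnorm (y - vk s) = vnorm u" "vnorm (y - z) = vnorm w"
    using v y z vnorm_minus_commute by (auto simp: u_def w_def intro!: eq_vecI)
  have 3: "(vnorm (w - a \<cdot>\<^sub>v u + b \<cdot>\<^sub>v g))\<^sup>2 =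
      w \<bullet> w + a * a * (u \<bullet> u) + b * b * (g \<bullet> g) - 2 * a * (u \<bullet> w) + 2 * b * (g \<bullet> w)
      - 2 * (a * b) * (g \<bullet> u)"
    using car comm_scalar_prod[of u n w] comm_scalar_prod[of g n w] comm_scalar_prod[of g n u]
    by (simp add: vnorm_power2 scalar_prod_add_distrib[of _ n] add_scalar_prod_distrib[of _ n]
        scalar_prod_minus_distrib[of _ n] minus_scalar_prod_distrib[of _ n]) (simp add: algebra_simps)
  have 4: "(vnorm (w - u))\<^sup>2 = w \<bullet> w + u \<bullet> u - 2 * (u \<bullet> w)"
    using car comm_scalar_prod[of u n w]
    by (simp add: vnorm_power2 scalar_prod_minus_distrib[of _ n] minus_scalar_prod_distrib[of _ n])
  have coeffs: "t\<^sup>2 / (2 * c') = b * b * c' / 2" "t * (1 - t) * c / c' = a * b * c'"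
    using c'_pos by (auto simp: a_def b_def power2_eq_square field_simps)
  have c'_eq: "b * c' * ell + a * c' = c'"
    unfolding ab by (simp add: c' algebra_simps)
  \<comment> \<open>Twice the coefficient of |u|^2 on the left side: the \<open>ell\<close> term of
    \<open>phi_next\<close> makes up the difference between a^2 c' and (1 - t) c.\<close>
  have "a * b * c' * ell + a * a * c' = a * (b * c' * ell + a * c')"
    by (simp add: algebra_simps)
  also have "\<dots> = (1 - t) * c"
    unfolding c'_eq by (rule ab(1))
  finally have uu: "a * b * c' * ell + a * a * c' = (1 - t) * c" .
  have "(1 - t) * phik s + t * f y - b * b * c' / 2 * (g \<bullet> g)
        + a * b * c' * (ell / 2 * (u \<bullet> u) + g \<bullet> u)
        + c' / 2 * (w \<bullet> w + a * a * (u \<bullet> u) + b * b * (g \<bullet> g) - 2 * a * (u \<bullet> w)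
            + 2 * b * (g \<bullet> w) - 2 * (a * b) * (g \<bullet> u)) =
      (1 - t) * phik s + t * f y + (b * c') * (g \<bullet> w) + c' / 2 * (w \<bullet> w) - (a * c') * (u \<bullet> w)
        + (a * b * c' * ell + a * a * c') / 2 * (u \<bullet> u)"
    by (simp add: algebra_simps add_divide_distrib diff_divide_distrib)
  also have "\<dots> = (1 - t) * phik s + t * f y + t * (g \<bullet> w) + c' / 2 * (w \<bullet> w)
        - (1 - t) * c * (u \<bullet> w) + (1 - t) * c / 2 * (u \<bullet> u)"
    by (simp only: ab uu)
  also have "\<dots> = (1 - t) * (phik s + c / 2 * (w \<bullet> w + u \<bullet> u - 2 * (u \<bullet> w)))
      + t * (f y + g \<bullet> w + ell / 2 * (w \<bullet> w))"
    unfolding c' by (simp add: algebra_simps add_divide_distrib diff_divide_distrib)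
  finally show ?thesis
    unfolding phi_next_def 1 2 3 4
    by (fold t_def c_def c'_def g_def u_def w_def)
      (simp only: coeffs 3 4 vnorm_power2)
qed

text \<open>The product \<open>\<kappa>\<close> of the factors 1 - theta_i is not part of the state,
  so it is carried as a witness. The square-root condition encodes \<kappa> \<le> 4/(k + 2)^2; the
  last inequality is the estimate-sequence property at \<open>xs\<close>.\<close>

definition estimate :: "nat \<Rightarrow> cag_state \<Rightarrow> real \<Rightarrow> bool" where
  "estimate k s \<kappa> \<longleftrightarrow>
     0 \<le> \<kappa> \<and> \<kappa> \<le> 1 \<and> gammak s = ell + \<kappa> * (L - ell) \<and>
     sqrt \<kappa> * (1 + real k / 2) \<le> 1 \<and> \<kappa> \<le> (1 - sqrt (ell / L)) ^ k \<and>
     phik s + gammak s / 2 * (vnorm (xs - vk s))\<^sup>2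
       \<le> (1 - \<kappa>) * f xs + \<kappa> * (f x0 + L / 2 * (vnorm (xs - x0))\<^sup>2)"

definition invariant :: "nat \<Rightarrow> cag_state \<Rightarrow> bool" where
  "invariant k s \<longleftrightarrow>
     xk s \<in> carrier_vec n \<and> vk s \<in> carrier_vec n \<and> pk s \<in> carrier_vec n \<and>
     0 < gammak s \<and> f (xk s) \<le> phik s \<and> (\<exists>\<kappa>. estimate k s \<kappa>)"

lemma estimate_step:
  assumes inv: "invariant k s" and y: "y \<in> carrier_vec n"
    and s': "vk s' = v_next s y" "phik s' = phi_next s y" "gammak s' = gamma_next s"
  shows "\<exists>\<kappa>. estimate (Suc k) s' \<kappa>"
proof -
  obtain \<kappa> where l: "estimate k s \<kappa>" and pos: "0 < gammak s" and v: "vk s \<in> carrier_vec n"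
    using inv by (auto simp: invariant_def)
  define t where "t = theta s"
  define \<mu> where "\<mu> = (1 - t) * \<kappa>"
  let ?P = "f x0 + L / 2 * (vnorm (xs - x0))\<^sup>2"
  have t: "0 < t" "t \<le> 1" "L * t\<^sup>2 = gamma_next s"
    using theta_props[OF pos] by (auto simp: t_def)
  have \<kappa>: "0 \<le> \<kappa>" "\<kappa> \<le> 1" "gammak s = ell + \<kappa> * (L - ell)"
    "sqrt \<kappa> * (1 + real k / 2) \<le> 1" "\<kappa> \<le> (1 - sqrt (ell / L)) ^ k"
    "phik s + gammak s / 2 * (vnorm (xs - vk s))\<^sup>2 \<le> (1 - \<kappa>) * f xs + \<kappa> * ?P"
    using l by (auto simp: estimate_def)
  have \<mu>: "0 \<le> \<mu>" "\<mu> \<le> 1"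
    using t \<kappa> by (auto simp: \<mu>_def intro: mult_le_one)
  have gamma: "gamma_next s = ell + \<mu> * (L - ell)"
    unfolding gamma_next_def \<mu>_def \<kappa>(3) t_def[symmetric] by (simp add: algebra_simps)
  \<comment> \<open>The new gamma is the average \<mu> L + (1 - \<mu>) ell, which dominates both
    \<mu> L and ell.\<close>
  have "\<mu> * L \<le> L * t\<^sup>2" "ell \<le> L * t\<^sup>2"
    using mult_right_mono[OF \<mu>(2) ell_nonneg] mult_nonneg_nonneg[OF \<mu>(1), of "L - ell"] ell_le
    unfolding t(3) gamma by (auto simp: algebra_simps)
  then have "\<mu> \<le> t\<^sup>2" "ell / L \<le> t\<^sup>2"
    using L_pos by (auto simp: field_simps)
  then have root: "sqrt \<mu> \<le> t" "sqrt (ell / L) \<le> t"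
    using t by (auto intro: real_le_lsqrt)
  have "sqrt \<mu> * ((1 + real k / 2) + 1 / 2) \<le> 1"
    using \<kappa> \<mu> root
    by (intro sqrt_contraction_step[where a = "sqrt \<kappa>" and \<theta> = t]) (auto simp: \<mu>_def)
  then have rate: "sqrt \<mu> * (1 + real (Suc k) / 2) \<le> 1"
    by (simp add: field_simps)
  have "\<mu> \<le> (1 - sqrt (ell / L)) * (1 - sqrt (ell / L)) ^ k"
    unfolding \<mu>_def using t root \<kappa> order_trans[OF root(2) t(2)] by (intro mult_mono) auto
  then have lin: "\<mu> \<le> (1 - sqrt (ell / L)) ^ Suc k"
    by simp
  have "phi_next s y + gamma_next s / 2 * (vnorm (xs - v_next s y))\<^sup>2
      = (1 - t) * (phik s + gammak s / 2 * (vnorm (xs - vk s))\<^sup>2)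
        + t * (f y + df y \<bullet> (xs - y) + ell / 2 * (vnorm (y - xs))\<^sup>2)"
    unfolding t_def by (rule estimate_update[OF pos v y xs_carrier])
  \<comment> \<open>The old estimate bounds the first summand; the lower model of f at
    \<open>y\<close> lies below \<open>f xs\<close>.\<close>
  also have "\<dots> \<le> (1 - t) * ((1 - \<kappa>) * f xs + \<kappa> * ?P) + t * f xs"
    using t \<kappa>(6) lower[OF y xs_carrier]
    by (intro add_mono[OF mult_left_mono mult_left_mono]) auto
  also have "\<dots> = (1 - \<mu>) * f xs + \<mu> * ?P"
    by (simp add: \<mu>_def algebra_simps)
  finally show ?thesis
    unfolding estimate_def s' using \<mu> gamma rate lin by blast
qed

section \<open>Preservation of the invariant and the evaluation count\<close>

text \<open>\<open>Failed\<close> is excluded because an iteration ends, at the latest, with an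
  accelerated step, which is always accepted.\<close>

definition admissible :: "nat \<Rightarrow> nat \<Rightarrow> outcome \<Rightarrow> bool" where
  "admissible k w r = (case r of
       Accepted s \<Rightarrow> invariant k s \<and> work s \<le> w
     | Failed s \<Rightarrow> False
     | Returned z w' \<Rightarrow> vnorm (df z) \<le> gtol \<and> w' \<le> w)"

text \<open>A failed step changes only the direction, the counters and the work, so the invariant
  survives with the same \<open>k\<close>. For an accepted step the acceptance test is the required
  bound by \<open>phi_next\<close>.\<close>

lemma cg_step_admissible:
  assumes inv: "invariant k s"
  shows "case cg_step b s of
      Failed s' \<Rightarrow> invariant k s' \<and> work s' \<le> work s + 2
    | r \<Rightarrow> admissible (Suc k) (work s + 2) r"
proof -
  have x: "xk s \<in> carrier_vec n" and v: "vk s \<in> carrier_vec n" and p: "pk s \<in> carrier_vec n"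
    and pos: "0 < gammak s"
    using inv by (auto simp: invariant_def)
  have g: "df (xk s) \<in> carrier_vec n"
    using x by (rule df_carrier)
  define p' where "p' = (if b \<or> icg s \<ge> 6 * n + 1 then - df (xk s) else pk s)"
  have p': "p' \<in> carrier_vec n"
    using p g by (simp add: p'_def)
  have failed: "invariant k s'"
    if "xk s' = xk s" "vk s' = vk s" "phik s' = phik s" "gammak s' = gammak s" "pk s' = p'" for s'
    using inv p' by (simp add: that invariant_def estimate_def)
  \<comment> \<open>The step length and the conjugacy coefficient \<open>beta\<close> enter as
    arbitrary scalars \<open>a\<close> and \<open>c\<close>.\<close>
  have accepted: "invariant (Suc k) s'"
    if "xk s' = xk s + a \<cdot>\<^sub>v p'" "vk s' = v_next s (xk s)" "phik s' = phi_next s (xk s)"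
      "gammak s' = gamma_next s" "pk s' = - df (xk s') + c \<cdot>\<^sub>v p'" "f (xk s') \<le> phi_next s (xk s)"
    for s' a c
  proof -
    have "xk s' \<in> carrier_vec n"
      using that(1) x p' by simp
    then show ?thesis
      using that x p' v_next_carrier[OF v x] gamma_next_pos[OF pos] df_carrier
        estimate_step[OF inv x, of s'] by (simp add: invariant_def)
  qed
  show ?thesis
    unfolding cg_step_def Let_def p'_def[symmetric]
    by (auto simp: admissible_def intro!: failed accepted)
qed

text \<open>The point \<open>y\<close> balances the gradient terms in \<open>vk s - y\<close> and
  \<open>xk s - y\<close>. Once \<open>phik s\<close> is bounded below by the linearization at
  \<open>y\<close>, these terms cancel, and what is left is the decrease guaranteed by the gradient
  step.\<close>

lemma accelerated_phi_ge:
  assumes inv: "invariant k s"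
    and y_def: "y = (1 / (gammak s + theta s * ell)) \<cdot>\<^sub>v
      ((theta s * gammak s) \<cdot>\<^sub>v vk s + gamma_next s \<cdot>\<^sub>v xk s)"
  shows "f (y - (1 / L) \<cdot>\<^sub>v df y) \<le> phi_next s y"
proof -
  have x: "xk s \<in> carrier_vec n" and v: "vk s \<in> carrier_vec n" and pos: "0 < gammak s"
    and phi: "f (xk s) \<le> phik s"
    using inv by (auto simp: invariant_def)
  have y: "y \<in> carrier_vec n"
    using x v by (simp add: y_def)
  define g where "g = df y"
  define t where "t = theta s"
  define c where "c = gammak s"
  define c' where "c' = gamma_next s"
  have g: "g \<in> carrier_vec n"
    using df_carrier[OF y] by (simp add: g_def)
  have t: "0 < t" "t \<le> 1" "L * t\<^sup>2 = c'"
    using theta_props[OF pos] by (auto simp: t_def c'_def)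
  have c'_pos: "0 < c'"
    using gamma_next_pos[OF pos] by (simp add: c'_def)
  \<comment> \<open>The normalizing factor of \<open>y\<close> is the sum of the two
    weights.\<close>
  have "c + t * ell = t * c + c'"
    by (simp add: c'_def gamma_next_def t_def c_def algebra_simps)
  moreover have "0 < t * c + c'"
    using t c'_pos pos by (simp add: c_def add_nonneg_pos)
  ultimately have "(t * c + c') * (g \<bullet> y) = t * c * (g \<bullet> vk s) + c' * (g \<bullet> xk s)"
    unfolding y_def using g x v
    by (fold t_def c_def c'_def) (simp add: scalar_prod_add_distrib[of _ n])
  then have "t * c * (g \<bullet> (vk s - y)) + c' * (g \<bullet> (xk s - y)) = 0"
    using g x v y by (simp add: scalar_prod_minus_distrib[of _ n] algebra_simps)
  then have bal: "t * c / c' * (g \<bullet> (vk s - y)) = - (g \<bullet> (xk s - y))"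
    using c'_pos by (simp add: field_simps)
  \<comment> \<open>By L t^2 = c' the gradient term of \<open>phi_next\<close> is exactly the
    decrease of the gradient step.\<close>
  have coeff: "t\<^sup>2 / (2 * c') = 1 / (2 * L)"
    using t L_pos by (simp flip: t(3))
  have "f (y - (1 / L) \<cdot>\<^sub>v df y) \<le> f y - (vnorm g)\<^sup>2 / (2 * L)"
    using gradient_step_decrease[OF y] by (simp add: g_def)
  also have "f y = (1 - t) * (f y + g \<bullet> (xk s - y)) + t * f y
      + (1 - t) * (t * c / c' * (g \<bullet> (vk s - y)))"
    unfolding bal by (simp add: algebra_simps)
  also have "\<dots> \<le> (1 - t) * phik s + t * f y
      + (1 - t) * (t * c / c' * (ell / 2 * (vnorm (y - vk s))\<^sup>2 + g \<bullet> (vk s - y)))"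
  proof (intro add_mono mult_left_mono order_refl)
    show "f y + g \<bullet> (xk s - y) \<le> phik s"
      using gradient_ineq[OF y x] phi by (simp add: g_def)
    show "g \<bullet> (vk s - y) \<le> ell / 2 * (vnorm (y - vk s))\<^sup>2 + g \<bullet> (vk s - y)"
      using ell_nonneg by simp
  qed (use t c'_pos pos in \<open>auto simp: c_def\<close>)
  finally show ?thesis
    unfolding phi_next_def
    by (fold t_def c_def c'_def g_def) (simp only: coeff, simp add: mult_ac)
qed

text \<open>The second evaluation in the bound is the one made at the new iterate in every eighth
  accelerated step.\<close>

lemma ag_step_admissible:
  assumes inv: "invariant k s"
  shows "admissible (Suc k) (work s + 2) (ag_step s)"
proof -
  have x: "xk s \<in> carrier_vec n" and v: "vk s \<in> carrier_vec n" and p: "pk s \<in> carrier_vec n"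
    and pos: "0 < gammak s"
    using inv by (auto simp: invariant_def)
  define y where "y = (1 / (gammak s + theta s * ell)) \<cdot>\<^sub>v
      ((theta s * gammak s) \<cdot>\<^sub>v vk s + gamma_next s \<cdot>\<^sub>v xk s)"
  have y: "y \<in> carrier_vec n"
    using x v by (simp add: y_def)
  have x': "y - (1 / L) \<cdot>\<^sub>v df y \<in> carrier_vec n"
    using y df_carrier[OF y] by simp
  have accepted: "invariant (Suc k) s'"
    if "xk s' = y - (1 / L) \<cdot>\<^sub>v df y" "vk s' = v_next s y" "phik s' = phi_next s y"
      "gammak s' = gamma_next s" "pk s' \<in> carrier_vec n" for s'
    using that x' v_next_carrier[OF v y] gamma_next_pos[OF pos]
      accelerated_phi_ge[OF inv y_def] estimate_step[OF inv y, of s']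
    by (simp add: invariant_def)
  show ?thesis
    unfolding ag_step_def Let_def y_def[symmetric]
    using p df_carrier[OF x'] by (auto simp: admissible_def intro!: accepted)
qed

lemma admissible_mono: "admissible k w r \<Longrightarrow> w \<le> w' \<Longrightarrow> admissible k w' r"
  by (auto simp: admissible_def split: outcome.splits)

text \<open>In the worst case all three step types are tried, at two evaluations each.\<close>

lemma iteration_admissible:
  assumes inv: "invariant k s"
  shows "admissible (Suc k) (work s + 6) (iteration s)"
proof (cases "onlyAG s")
  case True
  then show ?thesis
    using admissible_mono[OF ag_step_admissible[OF inv]] by (simp add: iteration_def)
next
  case False
  show ?thesis
  proof (cases "cg_step False s")
    case failed1: (Failed s1)
    then have s1: "invariant k s1" "work s1 \<le> work s + 2"
      using cg_step_admissible[OF inv, of False] by auto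
    show ?thesis
    proof (cases "cg_step True s1")
      case failed2: (Failed s2)
      then have "invariant k s2" "work s2 \<le> work s + 4"
        using cg_step_admissible[OF s1(1), of True] s1 by auto
      then show ?thesis
        using admissible_mono[OF ag_step_admissible, of k s2 "work s + 6"] False failed1 failed2
        by (simp add: iteration_def)
    qed (use cg_step_admissible[OF s1(1), of True] s1 False failed1 in
        \<open>auto simp: iteration_def intro: admissible_mono\<close>)
  qed (use cg_step_admissible[OF inv, of False] False in
      \<open>auto simp: iteration_def intro: admissible_mono\<close>)
qed

text \<open>The leading 1 is the evaluation at \<open>x0\<close>. The induction starts with
  \<open>\<kappa> = 1\<close>, where the estimate holds with equality.\<close>

lemma run_admissible: "admissible k (1 + 6 * k) (run k)"
proof (induction k)
  case 0
  have "1 - sqrt (ell / L) \<le> 1"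
    using ell_nonneg L_pos by simp
  then have "estimate 0 init 1"
    by (simp add: estimate_def init_def)
  then show ?case
    using x0 df_carrier[OF x0] L_pos by (auto simp: admissible_def invariant_def init_def)
next
  case (Suc k)
  show ?case
  proof (cases "run k")
    case (Accepted s)
    then have "invariant k s" "work s \<le> 1 + 6 * k"
      using Suc by (auto simp: admissible_def)
    then have "admissible (Suc k) (1 + 6 * Suc k) (iteration s)"
      by (intro admissible_mono[OF iteration_admissible]) auto
    then show ?thesis
      using Accepted by simp
  qed (use Suc in \<open>auto simp: admissible_def\<close>)
qed

section \<open>From the estimate to the two rates\<close>

text \<open>Reduces each rate to choosing a \<open>k\<close> for which the bounds on
  \<open>\<kappa>\<close> force \<open>\<kappa> \<le> \<epsilon>\<close>.\<close>

lemma reaches_withinI: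
  assumes B: "1 + 6 * real k \<le> B"
    and \<epsilon>: "\<And>\<kappa>. 0 \<le> \<kappa> \<Longrightarrow> sqrt \<kappa> * (1 + real k / 2) \<le> 1 \<Longrightarrow> \<kappa> \<le> (1 - sqrt (ell / L)) ^ k \<Longrightarrow> \<kappa> \<le> \<epsilon>"
  shows "reaches_within xs \<epsilon> B"
proof (cases "run k")
  case (Accepted s)
  then have inv: "invariant k s" and w: "work s \<le> 1 + 6 * k"
    using run_admissible[of k] by (auto simp: admissible_def)
  obtain \<kappa> where \<kappa>: "estimate k s \<kappa>"
    using inv by (auto simp: invariant_def)
  let ?D = "(vnorm (x0 - xs))\<^sup>2"
  have comm: "vnorm (xs - x0) = vnorm (x0 - xs)"
    using vnorm_minus_commute[OF xs_carrier x0] .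
  have "0 \<le> gammak s / 2 * (vnorm (xs - vk s))\<^sup>2"
    using inv by (simp add: invariant_def)
  moreover have "f (xk s) \<le> phik s"
    using inv by (simp add: invariant_def)
  moreover have "phik s + gammak s / 2 * (vnorm (xs - vk s))\<^sup>2
      \<le> (1 - \<kappa>) * f xs + \<kappa> * (f x0 + L / 2 * ?D)"
    using \<kappa> unfolding estimate_def comm by blast
  ultimately have "f (xk s) \<le> (1 - \<kappa>) * f xs + \<kappa> * (f x0 + L / 2 * ?D)"
    by linarith
  then have "f (xk s) - f xs \<le> \<kappa> * (f x0 - f xs + L / 2 * ?D)"
    by (simp add: algebra_simps)
  also have "\<dots> \<le> \<kappa> * (L * ?D)"
    using \<kappa> minimizer_residual_le[OF smooth minimizer x0]
    by (intro mult_left_mono) (auto simp: estimate_def)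
  also have "\<dots> \<le> \<epsilon> * (L * ?D)"
    using \<kappa> L_pos by (intro mult_right_mono \<epsilon>) (auto simp: estimate_def)
  finally have "f (xk s) - f xs \<le> \<epsilon> * (L * ?D)" .
  moreover have "real (work s) \<le> B"
    using w B by linarith
  ultimately show ?thesis
    using Accepted unfolding reaches_within_def by blast
next
  \<comment> \<open>A return in an earlier iteration is propagated by \<open>run\<close>, so it is
    still visible at \<open>k\<close>.\<close>
  case (Returned z w)
  then have "vnorm (df z) \<le> gtol" "w \<le> 1 + 6 * k"
    using run_admissible[of k] by (auto simp: admissible_def)
  moreover from this have "real w \<le> B"
    using B by linarith
  ultimately show ?thesis
    using Returned unfolding reaches_within_def by blast
qed (use run_admissible[of k] in \<open>simp add: admissible_def\<close>)

lemma sublinear_bound: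
  assumes "0 < \<epsilon>" "\<epsilon> \<le> 1"
  shows "reaches_within xs \<epsilon> (19 * \<epsilon> powr (- 1 / 2))"
proof -
  define r where "r = 1 / sqrt \<epsilon>"
  have "\<epsilon> powr (- (1 / 2)) = r"
    unfolding powr_minus_divide r_def using assms by (simp add: powr_half_sqrt)
  then have r: "\<epsilon> powr (- 1 / 2) = r"
    by simp
  have r1: "1 \<le> r"
    using assms by (simp add: r_def)
  \<comment> \<open>Then 1 + k/2 \<ge> r, and the work is at most 1 + 6 (2r + 1) = 12r + 7 \<le> 19r
    since r \<ge> 1.\<close>
  define k where "k = nat \<lceil>2 * r\<rceil>"
  have k: "2 * r \<le> real k" "real k \<le> 2 * r + 1"
    using r1 unfolding k_def by linarith+
  have "reaches_within xs \<epsilon> (19 * r)"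
  proof (rule reaches_withinI[of k])
    show "1 + 6 * real k \<le> 19 * r"
      using k r1 by linarith
    fix \<kappa>
    assume \<kappa>: "0 \<le> \<kappa>" "sqrt \<kappa> * (1 + real k / 2) \<le> 1"
    have "sqrt \<kappa> * r \<le> sqrt \<kappa> * (1 + real k / 2)"
      using k \<kappa> by (intro mult_left_mono) auto
    then have "sqrt \<kappa> * r \<le> 1"
      using \<kappa> by linarith
    then have "sqrt \<kappa> \<le> sqrt \<epsilon>"
      using assms by (simp add: r_def)
    then show "\<kappa> \<le> \<epsilon>"
      by simp
  qed
  then show ?thesis
    by (simp only: r)
qed

lemma linear_bound:
  assumes "0 < ell" "0 < \<epsilon>" "\<epsilon> \<le> 1 / 2"
  shows "reaches_within xs \<epsilon> (20 * (sqrt (L / ell) * ln (1 / \<epsilon>)))"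
proof -
  define q where "q = sqrt (ell / L)"
  have q: "0 < q" "q \<le> 1"
    using assms L_pos ell_le by (auto simp: q_def)
  have inv_q: "sqrt (L / ell) = 1 / q"
    by (simp add: q_def real_sqrt_divide)
  \<comment> \<open>From ln \<epsilon> \<le> \<epsilon> - 1 \<le> -1/2. This lower bound lets the
    additive constants be absorbed.\<close>
  have ln: "1 / 2 \<le> ln (1 / \<epsilon>)"
    using assms ln_le_minus_one[of \<epsilon>] by (simp add: ln_div)
  define S where "S = 1 / q * ln (1 / \<epsilon>)"
  have "1 * ln (1 / \<epsilon>) \<le> S"
    unfolding S_def using q ln by (intro mult_right_mono) auto
  then have S: "1 / 2 \<le> S"
    using ln by linarith
  \<comment> \<open>The work is at most 1 + 6 (S + 1) = 6S + 7 \<le> 20S since S \<ge> 1/2.\<close>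
  define k where "k = nat \<lceil>S\<rceil>"
  have k: "S \<le> real k" "real k \<le> S + 1"
    using S unfolding k_def by linarith+
  have "reaches_within xs \<epsilon> (20 * S)"
  proof (rule reaches_withinI[of k])
    show "1 + 6 * real k \<le> 20 * S"
      using k S by linarith
    fix \<kappa>
    assume "\<kappa> \<le> (1 - sqrt (ell / L)) ^ k"
    \<comment> \<open>By 1 - q \<le> exp (-q); the chain ends at \<epsilon> because q S = ln
      (1/\<epsilon>).\<close>
    also have "\<dots> \<le> exp (- q) ^ k"
      using q exp_ge_add_one_self[of "- q"] unfolding q_def[symmetric] by (intro power_mono) auto
    also have "\<dots> = exp (- (q * real k))"
      by (simp add: exp_of_nat_mult[symmetric] mult.commute)
    also have "\<dots> \<le> exp (- (q * S))"
      using q k by simp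
    also have "\<dots> = \<epsilon>"
      using q assms by (simp add: S_def ln_div)
    finally show "\<kappa> \<le> \<epsilon>" .
  qed
  then show ?thesis
    by (simp only: inv_q S_def)
qed

end

text \<open>Brings the hypotheses of both claims into the common setting; for \<open>ell = 0\<close>
  convexity supplies the lower bound.\<close>

lemma cag_convergenceI:
  assumes "1 \<le> n" "0 < L" "L_smooth n L f df" "0 \<le> ell" "ell \<noteq> 0 \<Longrightarrow> strongly_convex n ell f df"
    "x0 \<in> carrier_vec n" "is_minimizer n f xs"
  shows "cag_convergence n f df L ell x0 xs"
proof
  show "ell \<le> L"
    using assms strong_convexity_le_smoothness by (cases "ell = 0") auto
  show "ell / 2 * (vnorm (x - y))\<^sup>2 \<le> f y - f x - df x \<bullet> (y - x)"
    if "x \<in> carrier_vec n" "y \<in> carrier_vec n" for x y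
  proof (cases "ell = 0")
    case True
    then show ?thesis
      using convex_fun_gradient_ineq[of n f df x y] assms(3) that by (simp add: L_smooth_def)
  next
    case False
    then show ?thesis
      using assms(5) that by (simp add: strongly_convex_def)
  qed
qed (use assms in auto)

theorem mainTheorem2:
  shows
    "(\<exists>C::real. \<forall>(n::nat) (f :: real vec \<Rightarrow> real) (df :: real vec \<Rightarrow> real vec)
        (L::real) (ell::real) (gtol::real) (x0 :: real vec) (xs :: real vec) (\<epsilon>::real).
        1 \<le> n \<and> 0 < L \<and> L_smooth n L f df \<and>
        0 \<le> ell \<and> (ell \<noteq> 0 \<longrightarrow> strongly_convex n ell f df) \<and>
        0 \<le> gtol \<and> x0 \<in> carrier_vec n \<and> is_minimizer n f xs \<and> 0 < \<epsilon> \<and> \<epsilon> \<le> 1 / 2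
        \<longrightarrow> cag.reaches_within n f df L ell gtol x0 xs \<epsilon> (C * \<epsilon> powr (- 1 / 2)))
   \<and> (\<exists>C::real. \<forall>(n::nat) (f :: real vec \<Rightarrow> real) (df :: real vec \<Rightarrow> real vec)
        (L::real) (ell::real) (gtol::real) (x0 :: real vec) (xs :: real vec) (\<epsilon>::real).
        1 \<le> n \<and> 0 < L \<and> L_smooth n L f df \<and>
        0 < ell \<and> strongly_convex n ell f df \<and>
        0 \<le> gtol \<and> x0 \<in> carrier_vec n \<and> is_minimizer n f xs \<and> 0 < \<epsilon> \<and> \<epsilon> \<le> 1 / 2
        \<longrightarrow> cag.reaches_within n f df L ell gtol x0 xs \<epsilon> (C * (sqrt (L / ell) * ln (1 / \<epsilon>))))"
proof (intro conjI exI allI impI; elim conjE)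
  fix n f df L ell gtol and x0 xs :: "real vec" and \<epsilon> :: real
  assume "1 \<le> n" "0 < L" "L_smooth n L f df" "0 \<le> ell" "ell \<noteq> 0 \<longrightarrow> strongly_convex n ell f df"
    "x0 \<in> carrier_vec n" "is_minimizer n f xs" and \<epsilon>: "0 < \<epsilon>" "\<epsilon> \<le> 1 / 2"
  then interpret cag_convergence n f df L ell gtol x0 xs
    by (intro cag_convergenceI) auto
  \<comment> \<open>\<open>exI\<close> left C schematic outside the universal quantifiers; it is
    instantiated here by an absolute constant, independent of the dimension and of
    \<open>f\<close>.\<close>
  show "reaches_within xs \<epsilon> (19 * \<epsilon> powr (- 1 / 2))"
    using \<epsilon> by (intro sublinear_bound) auto
next
  fix n f df L ell gtol and x0 xs :: "real vec" and \<epsilon> :: real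
  assume "1 \<le> n" "0 < L" "L_smooth n L f df" and ell: "0 < ell" and "strongly_convex n ell f df"
    "x0 \<in> carrier_vec n" "is_minimizer n f xs" and \<epsilon>: "0 < \<epsilon>" "\<epsilon> \<le> 1 / 2"
  then interpret cag_convergence n f df L ell gtol x0 xs
    by (intro cag_convergenceI) auto
  show "reaches_within xs \<epsilon> (20 * (sqrt (L / ell) * ln (1 / \<epsilon>)))"
    using ell \<epsilon> by (rule linear_bound)
qed

end
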